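(* There is a universal constant $c$ with $0<c\le 1/36$ such that the following holds. Let $n$ be a perfect square. Suppose a randomized cell probe data structure for the $u^{T}Mv$ problem on matrices $M\in\mathbb{F}_2^{\sqrt n\times\sqrt n}$ has space $s$, word size $w$ and query time $t$, and for every matrix $M$ and every query $(u,v)\in\mathbb{F}_2^{\sqrt n}\times\mathbb{F}_2^{\sqrt n}$ it correctly outputs $u^{T}Mv$ with probability at least $\frac12+\frac{1}{2^{\sqrt n/64}}$. Then \[ t\ \ge\ \min\left\{\frac{c\sqrt n}{\log\frac{s\alpha}{n}},\ \frac{cn}{\alpha}\right\},\qquad\text{where } \alpha:=2\left(w+\log\frac{sw}{n}\right).\]
   Context: In the $u^{T}Mv$ problem over $\mathbb{F}_2$, the input data is a matrix $M\in\mathbb{F}_2^{\sqrt n\times\sqrt n}$ and a query is a pair of vectors $u,v\in\mathbb{F}_2^{\sqrt n}$, whose answer is the bit $u^{T}Mv$. In the cell probe model, a data structure with space $s$ and word size $w$ stores, on input $M$, $s$ cells each containing $w$ bits, which may be arbitrary functions of $M$; the query algorithm, given a query, adaptively reads (probes) at most $t$ cells and outputs an answer that is an arbitrary function of the query and the contents read; $t$ is the query time. In a randomized data structure, the preprocessing and query algorithm may use randomness, and the probability is over this randomness. Logarithms are base 2. *)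

theory Defs
  imports
    "HOL-Probability.Probability_Mass_Function"
    "HOL-Library.Z2"
    "Jordan_Normal_Form.Matrix"
begin

text \<open>An adaptive cell probe algorithm with its input fixed: each address to be probed may depend
  on the contents read so far, and so may the final output. Memory is addressed by natural
  numbers, and the content of a cell is a bit string.\<close>

datatype 'a probe_alg =
    Output 'a
  | Probe nat "bool list \<Rightarrow> 'a probe_alg"

primrec run :: "(nat \<Rightarrow> bool list) \<Rightarrow> 'a probe_alg \<Rightarrow> 'a" where
  "run mem (Output a) = a"
| "run mem (Probe i k) = run mem (k (mem i))"

primrec probes :: "(nat \<Rightarrow> bool list) \<Rightarrow> 'a probe_alg \<Rightarrow> nat list" where
  "probes mem (Output a) = []"
| "probes mem (Probe i k) = i # probes mem (k (mem i))"

record ('d, 'q, 'a) data_structure =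
  store :: "'d \<Rightarrow> nat \<Rightarrow> bool list"
  query :: "'q \<Rightarrow> 'a probe_alg"

definition answer :: "('d, 'q, 'a) data_structure \<Rightarrow> 'd \<Rightarrow> 'q \<Rightarrow> 'a" where
  "answer S x q = run (store S x) (query S q)"

text \<open>Space \<open>s\<close>, word size \<open>w\<close> and worst-case query time \<open>t\<close> on the inputs \<open>D\<close> and queries \<open>Q\<close>.
  The bounds on the probes concern only memory contents that are stored for some input.\<close>

definition cell_probe_ds ::
    "'d set \<Rightarrow> 'q set \<Rightarrow> nat \<Rightarrow> nat \<Rightarrow> nat \<Rightarrow> ('d, 'q, 'a) data_structure \<Rightarrow> bool" where
  "cell_probe_ds D Q s w t S \<longleftrightarrow>
     (\<forall>x\<in>D. \<forall>i<s. length (store S x i) = w) \<and>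
     (\<forall>x\<in>D. \<forall>q\<in>Q. set (probes (store S x) (query S q)) \<subseteq> {..<s} \<and>
                  length (probes (store S x) (query S q)) \<le> t)"

text \<open>A randomized data structure is a probability distribution over deterministic ones. The
  preprocessing and the query algorithm are drawn jointly, so that shared randomness is allowed
  (independent randomness is the special case of a product distribution). Discrete distributions
  suffice: for finite \<open>D\<close> and \<open>Q\<close> there are, up to their behaviour on \<open>D\<close> and \<open>Q\<close>, only finitely
  many deterministic data structures with given parameters.\<close>

definition randomized_cell_probe_ds ::
    "'d set \<Rightarrow> 'q set \<Rightarrow> nat \<Rightarrow> nat \<Rightarrow> nat \<Rightarrow> ('d, 'q, 'a) data_structure pmf \<Rightarrow> bool" where
  "randomized_cell_probe_ds D Q s w t R \<longleftrightarrow> (\<forall>S\<in>set_pmf R. cell_probe_ds D Q s w t S)"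

definition solves_with_prob ::
    "'d set \<Rightarrow> 'q set \<Rightarrow> ('d \<Rightarrow> 'q \<Rightarrow> 'a) \<Rightarrow> real \<Rightarrow> ('d, 'q, 'a) data_structure pmf \<Rightarrow> bool" where
  "solves_with_prob D Q f p R \<longleftrightarrow>
     (\<forall>x\<in>D. \<forall>q\<in>Q. measure_pmf.prob R {S. answer S x q = f x q} \<ge> p)"

text \<open>The type \<open>bit\<close> is the field with two elements.\<close>

definition uMv_inputs :: "nat \<Rightarrow> bit Matrix.mat set" where
  "uMv_inputs m = carrier_mat m m"

definition uMv_queries :: "nat \<Rightarrow> (bit Matrix.vec \<times> bit Matrix.vec) set" where
  "uMv_queries m = carrier_vec m \<times> carrier_vec m"

definition uMv :: "bit Matrix.mat \<Rightarrow> bit Matrix.vec \<times> bit Matrix.vec \<Rightarrow> bit" where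
  "uMv M = (\<lambda>(u, v). scalar_prod u (M *\<^sub>v v))"

end

theory Submission
  imports Defs
begin

text \<open>Combine cell sampling with a high-moment discrepancy bound. For a set of \<open>q\<close> cells chosen
  independently of \<open>M\<close>, keep only the queries all of whose probes (padded to exactly \<open>\<tau>\<close> cells) fall
  into the set. On average over the set this multiplies the total advantage over \<open>1/2\<close> by
  \<open>(q choose \<tau>) / (s choose \<tau>)\<close>. The kept answers are determined by \<open>q w\<close> bits, and for each
  value of these bits they form a fixed weight function \<open>\<sigma>\<close> on the queries. Since \<open>\<bar>\<sigma>\<bar> \<le> 1\<close>
  and all mixed moments of the signs \<open>(-1)^(u\<^sup>T M v)\<close> are nonnegative, the \<open>2m\<close>-th moment over random
  \<open>M\<close> of the correlation with \<open>\<sigma>\<close> is largest for \<open>\<sigma> = 1\<close>, where the correlation is \<open>2^m\<close>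
  times the size of the kernel of \<open>M\<close>. Hence the relative advantage that survives is at most
  \<open>2 powr (q w / (2 m) - m / 2 + 1 / 2)\<close>.
  With \<open>q = s\<close> this rules out \<open>s w < 7 n / 8\<close>; otherwise \<open>\<alpha> \<ge> w\<close> and \<open>s \<alpha> / n \<ge> 7 / 5\<close>, and
  \<open>q = n / (2 \<alpha>)\<close>, rounded down, gives the trade-off.\<close>

subsection \<open>Moments of the kernel size over the field with two elements\<close>

definition sgn_bit :: "bit \<Rightarrow> real" where
  "sgn_bit b = (if b = 0 then 1 else - 1)"

lemma sgn_bit_simps [simp]: "sgn_bit 0 = 1" "sgn_bit 1 = - 1"
  by (simp_all add: sgn_bit_def)

lemma sgn_bit_add: "sgn_bit (a + b) = sgn_bit a * sgn_bit b"
  by (cases a; cases b) simp_all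

lemma bit_add_cancel: "a + (a + b) = (b::bit)"
  by (cases a; cases b) simp_all

lemma abs_sgn_bit [simp]: "\<bar>sgn_bit b\<bar> = 1"
  by (simp add: sgn_bit_def)

text \<open>Reindexing by \<open>T\<close> multiplies the sum by \<open>c \<noteq> 1\<close>. This
  is character orthogonality, needed for vectors and for matrices.\<close>

lemma sum_character_eq_0:
  fixes \<psi> :: "'a \<Rightarrow> real"
  assumes "bij_betw T A A" "\<And>x. x \<in> A \<Longrightarrow> \<psi> (T x) = c * \<psi> x" "c \<noteq> 1"
  shows "sum \<psi> A = 0"
proof -
  have "sum \<psi> A = (\<Sum>x\<in>A. \<psi> (T x))"
    using sum.reindex_bij_betw[OF assms(1), of \<psi>] by simp
  also have "\<dots> = c * sum \<psi> A"
    by (simp add: assms(2) sum_distrib_left)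
  finally show ?thesis
    using assms(3) by simp
qed

lemma bij_betw_involution:
  assumes "\<And>x. x \<in> A \<Longrightarrow> f x \<in> A" "\<And>x. x \<in> A \<Longrightarrow> f (f x) = x"
  shows "bij_betw f A A"
  by (rule bij_betw_byWitness[where f' = f]) (use assms in auto)

lemma bit_vec_add_cancel:
  fixes u v :: "bit Matrix.vec"
  assumes "u \<in> carrier_vec m" "v \<in> carrier_vec m"
  shows "u + (u + v) = v"
  using assms by (intro eq_vecI) (auto simp: bit_add_cancel simp del: add_bit_eq_xor)

lemma bit_mat_add_cancel:
  fixes A B :: "bit Matrix.mat"
  assumes "A \<in> carrier_mat m k" "B \<in> carrier_mat m k"
  shows "A + (A + B) = B"
  using assms by (intro eq_matI) (auto simp: bit_add_cancel simp del: add_bit_eq_xor)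

section \<open>Counting bit vectors and bit matrices\<close>

lemma UNIV_bit: "(UNIV :: bit set) = {0, 1}"
proof -
  have "x = 0 \<or> x = 1" for x :: bit by (cases x) auto
  then show ?thesis by auto
qed

lemma bij_betw_vec_of_list: "bij_betw vec_of_list {xs :: 'a list. length xs = m} (carrier_vec m)"
proof (rule bij_betw_byWitness[where f' = list_of_vec])
  show "vec_of_list ` {xs :: 'a list. length xs = m} \<subseteq> carrier_vec m"
    by (rule image_subsetI) (simp add: carrier_vecI)
  show "list_of_vec ` carrier_vec m \<subseteq> {xs :: 'a list. length xs = m}"
    by (rule image_subsetI) simp
qed (simp_all add: vec_list list_vec)

lemma card_bit_vec: "card (carrier_vec m :: bit Matrix.vec set) = 2 ^ m"
  and finite_bit_vec [simp]: "finite (carrier_vec m :: bit Matrix.vec set)"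
proof -
  have b: "finite (UNIV :: bit set)" "card (UNIV :: bit set) = 2"
    by (simp_all add: UNIV_bit)
  show "card (carrier_vec m :: bit Matrix.vec set) = 2 ^ m"
    using bij_betw_same_card[OF bij_betw_vec_of_list[of m, where 'a = bit]]
      card_lists_length_eq[OF b(1), of m] b(2) by simp
  show "finite (carrier_vec m :: bit Matrix.vec set)"
    using bij_betw_finite[OF bij_betw_vec_of_list[of m, where 'a = bit]]
      finite_lists_length_eq[OF b(1), of m] by simp
qed

lemma bij_betw_rows:
  "bij_betw rows (carrier_mat m k :: 'a Matrix.mat set) {rs. set rs \<subseteq> carrier_vec k \<and> length rs = m}"
proof (rule bij_betw_byWitness[where f' = "mat_of_rows k"])
  show "rows ` carrier_mat m k \<subseteq> {rs. set rs \<subseteq> carrier_vec k \<and> length rs = m}"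
    using rows_carrier by fastforce
qed auto

lemma card_bit_mat: "card (carrier_mat m k :: bit Matrix.mat set) = 2 ^ (m * k)"
  and finite_bit_mat [simp]: "finite (carrier_mat m k :: bit Matrix.mat set)"
proof -
  show "card (carrier_mat m k :: bit Matrix.mat set) = 2 ^ (m * k)"
    using bij_betw_same_card[OF bij_betw_rows[of m k, where 'a = bit]]
      card_lists_length_eq[OF finite_bit_vec, of k m]
    by (simp add: card_bit_vec power_mult[symmetric] mult.commute)
  show "finite (carrier_mat m k :: bit Matrix.mat set)"
    using bij_betw_finite[OF bij_betw_rows[of m k, where 'a = bit]]
      finite_lists_length_eq[OF finite_bit_vec, of k m] by simp
qed

section \<open>Annihilators: orthogonal complements, and kernels when the vectors are the rows of a
  matrix\<close>

definition annihilator :: "nat \<Rightarrow> bit Matrix.vec set \<Rightarrow> bit Matrix.vec set" where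
  "annihilator m A = {v \<in> carrier_vec m. \<forall>r\<in>A. scalar_prod r v = 0}"

lemma annihilator_subset: "annihilator m A \<subseteq> carrier_vec m"
  by (auto simp: annihilator_def)

lemma finite_annihilator [simp]: "finite (annihilator m A)"
  by (rule finite_subset[OF annihilator_subset]) simp

lemma zero_in_annihilator: "A \<subseteq> carrier_vec m \<Longrightarrow> 0\<^sub>v m \<in> annihilator m A"
  by (auto simp: annihilator_def)

lemma annihilator_add:
  assumes "A \<subseteq> carrier_vec m" "u \<in> annihilator m A" "v \<in> annihilator m A"
  shows "u + v \<in> annihilator m A"
  using assms scalar_prod_add_distrib[of _ m u v] by (auto simp: annihilator_def subset_eq)

lemma annihilator_carrier: "annihilator m (carrier_vec m) = {0\<^sub>v m}"
proof -
  have "v = 0\<^sub>v m" if v: "v \<in> annihilator m (carrier_vec m)" for v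
  proof (rule eq_vecI)
    fix i assume i: "i < dim_vec (0\<^sub>v m :: bit Matrix.vec)"
    have "scalar_prod (unit_vec m i) v = 0" "v \<in> carrier_vec m"
      using v by (auto simp: annihilator_def)
    then show "Matrix.vec_index v i = Matrix.vec_index (0\<^sub>v m) i"
      using i by simp
  qed (use v in \<open>auto simp: annihilator_def\<close>)
  then show ?thesis
    by (auto simp: zero_in_annihilator)
qed

text \<open>If some \<open>h\<close> in \<open>W\<close> pairs to 1 with \<open>r\<close>,
  translation by \<open>h\<close> permutes \<open>W\<close> and flips every sign. In characteristic
  2, closure under addition already makes a nonempty \<open>W\<close> a subspace.\<close>

lemma sum_sgn_scalar_prod:
  fixes r :: "bit Matrix.vec"
  assumes W: "W \<subseteq> carrier_vec m" and add: "\<And>u v. u \<in> W \<Longrightarrow> v \<in> W \<Longrightarrow> u + v \<in> W"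
    and r: "r \<in> carrier_vec m"
  shows "(\<Sum>v\<in>W. sgn_bit (scalar_prod r v)) = (if r \<in> annihilator m W then real (card W) else 0)"
proof (cases "r \<in> annihilator m W")
  case True
  have "scalar_prod r v = 0" if "v \<in> W" for v
    using True that W r comm_scalar_prod[of r m v] by (auto simp: annihilator_def)
  then show ?thesis using True by simp
next
  case False
  then obtain h where h: "h \<in> W" "scalar_prod h r \<noteq> 0"
    using r by (auto simp: annihilator_def)
  have hr: "scalar_prod r h = 1"
    using h W r comm_scalar_prod[of r m h] by (cases "scalar_prod r h") auto
  have "bij_betw ((+) h) W W"
    by (rule bij_betw_involution) (use h W add bit_vec_add_cancel[of h m] in auto)
  moreover have "sgn_bit (scalar_prod r (h + v)) = - 1 * sgn_bit (scalar_prod r v)" if "v \<in> W" for v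
    using that h W r hr by (subst scalar_prod_add_distrib[of _ m]) (auto simp: sgn_bit_add)
  ultimately have "(\<Sum>v\<in>W. sgn_bit (scalar_prod r v)) = 0"
    by (rule sum_character_eq_0) auto
  then show ?thesis using False by simp
qed

text \<open>Double counting of the signs over all \<open>r\<close> and all \<open>v\<close> in the
  annihilator: for fixed \<open>r\<close> only the double annihilator contributes, for fixed
  \<open>v\<close> only \<open>v = 0\<close>. It replaces rank-nullity.\<close>

lemma card_annihilator_mult:
  assumes "A \<subseteq> carrier_vec m"
  shows "card (annihilator m A) * card (annihilator m (annihilator m A)) = 2 ^ m"
proof -
  let ?K = "annihilator m A" and ?V = "carrier_vec m :: bit Matrix.vec set"
  have "real (card ?K * card (annihilator m ?K))
      = (\<Sum>r\<in>?V. if r \<in> annihilator m ?K then real (card ?K) else 0)"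
    using annihilator_subset[of m ?K]
    by (subst sum.inter_restrict[symmetric]) (auto simp: Int_absorb1)
  also have "\<dots> = (\<Sum>r\<in>?V. \<Sum>v\<in>?K. sgn_bit (scalar_prod r v))"
    by (rule sum.cong[OF refl], rule sum_sgn_scalar_prod[symmetric])
      (use assms annihilator_subset annihilator_add in auto)
  also have "\<dots> = (\<Sum>v\<in>?K. \<Sum>r\<in>?V. sgn_bit (scalar_prod r v))"
    by (rule sum.swap)
  also have "\<dots> = (\<Sum>v\<in>?K. \<Sum>r\<in>?V. sgn_bit (scalar_prod v r))"
    using annihilator_subset[of m A] comm_scalar_prod[of _ m]
    by (intro sum.cong refl arg_cong[of _ _ sgn_bit]) blast
  also have "\<dots> = (\<Sum>v\<in>?K. if v = 0\<^sub>v m then 2 ^ m else 0)"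
    using annihilator_subset[of m A]
    by (intro sum.cong refl, subst sum_sgn_scalar_prod[of _ m])
      (auto simp: annihilator_carrier card_bit_vec)
  also have "\<dots> = 2 ^ m"
    using zero_in_annihilator[OF assms] by (subst sum.delta) auto
  finally show ?thesis
    by (metis of_nat_eq_iff of_nat_numeral of_nat_power)
qed

text \<open>The signs of \<open>r\<close> over the annihilator of \<open>A\<close> sum to 0, so the
  vectors pairing to 0 and to 1 with \<open>r\<close> are equally many.\<close>

lemma card_annihilator_insert:
  assumes A: "A \<subseteq> carrier_vec m" and r: "r \<in> carrier_vec m" "r \<notin> annihilator m (annihilator m A)"
  shows "real (card (annihilator m (insert r A))) = real (card (annihilator m A)) / 2"
proof -
  let ?K = "annihilator m A"
  let ?Z = "{v \<in> ?K. scalar_prod r v = 0}" and ?N = "{v \<in> ?K. scalar_prod r v \<noteq> 0}"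
  have eq: "annihilator m (insert r A) = ?Z"
    by (auto simp: annihilator_def)
  have u: "?K = ?Z \<union> ?N" by blast
  have "card (?Z \<union> ?N) = card ?Z + card ?N"
    by (rule card_Un_disjoint) auto
  then have c: "card ?K = card ?Z + card ?N"
    by (simp only: u[symmetric])
  have "0 = (\<Sum>v\<in>?K. sgn_bit (scalar_prod r v))"
    by (subst sum_sgn_scalar_prod[of _ m])
      (use A r annihilator_subset annihilator_add in auto)
  also have "\<dots> = (\<Sum>v\<in>?Z \<union> ?N. sgn_bit (scalar_prod r v))"
    by (simp only: u[symmetric])
  also have "\<dots> = (\<Sum>v\<in>?Z. sgn_bit (scalar_prod r v)) + (\<Sum>v\<in>?N. sgn_bit (scalar_prod r v))"
    by (rule sum.union_disjoint) auto
  also have "\<dots> = real (card ?Z) - real (card ?N)"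
    by simp
  finally show ?thesis
    using c eq by simp
qed

lemma sum_lists_Suc:
  "(\<Sum>xs | set xs \<subseteq> A \<and> length xs = Suc n. f xs)
    = (\<Sum>xs | set xs \<subseteq> A \<and> length xs = n. \<Sum>x\<in>A. f (x # xs))"
proof -
  have "(\<Sum>xs | set xs \<subseteq> A \<and> length xs = Suc n. f xs)
      = (\<Sum>(xs, x)\<in>{xs. set xs \<subseteq> A \<and> length xs = n} \<times> A. f (x # xs))"
    by (rule sum.reindex_bij_witness[of _ "\<lambda>(xs, x). x # xs" "\<lambda>xs. (tl xs, hd xs)"])
      (auto simp: length_Suc_conv)
  then show ?thesis
    by (simp add: sum.cartesian_product)
qed

text \<open>Adding a row halves the annihilator unless the row lies in its double annihilator, which
  contains \<open>2 ^ m / card K\<close> vectors when the annihilator is \<open>K\<close>.\<close>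

lemma sum_card_annihilator_power_le:
  assumes "m + j \<le> k"
  shows "(\<Sum>rs | set rs \<subseteq> carrier_vec m \<and> length rs = j. real (card (annihilator m (set rs))) ^ k)
           \<le> 2 ^ j * 2 ^ (m * k)"
  using assms
proof (induction j arbitrary: k)
  case 0
  have "annihilator m {} = carrier_vec m" by (auto simp: annihilator_def)
  moreover have "{rs :: bit Matrix.vec list. set rs \<subseteq> carrier_vec m \<and> length rs = 0} = {[]}" by auto
  ultimately show ?case by (simp add: card_bit_vec power_mult)
next
  case (Suc j)
  let ?L = "{rs :: bit Matrix.vec list. set rs \<subseteq> carrier_vec m \<and> length rs = j}"
  let ?V = "carrier_vec m :: bit Matrix.vec set"
  obtain k' where k': "k = Suc k'" "m + j \<le> k'"
    using Suc.prems by (cases k) auto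
  have step: "(\<Sum>r\<in>?V. real (card (annihilator m (set (r # rs)))) ^ k)
      \<le> 2 ^ m * real (card (annihilator m (set rs))) ^ k'
        + real (card (annihilator m (set rs))) ^ k" if rs: "rs \<in> ?L" for rs
  proof -
    let ?K = "annihilator m (set rs)"
    let ?P = "annihilator m ?K"
    have rsV: "set rs \<subseteq> ?V" using rs by auto
    have P: "?P \<subseteq> ?V" by (rule annihilator_subset)
    have in_P: "real (card (annihilator m (set (r # rs)))) ^ k \<le> real (card ?K) ^ k" for r
      by (intro power_mono of_nat_mono card_mono) (auto simp: annihilator_def)
    have not_in_P: "real (card (annihilator m (set (r # rs)))) ^ k = real (card ?K) ^ k / 2 ^ k"
      if "r \<in> ?V - ?P" for r
    proof -
      have "real (card (annihilator m (set (r # rs)))) = real (card ?K) / 2"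
        using card_annihilator_insert[OF rsV, of r] that by simp
      then show ?thesis
        by (simp only: power_divide)
    qed
    have "(\<Sum>r\<in>?V. real (card (annihilator m (set (r # rs)))) ^ k)
        = (\<Sum>r\<in>?V - ?P. real (card (annihilator m (set (r # rs)))) ^ k)
          + (\<Sum>r\<in>?P. real (card (annihilator m (set (r # rs)))) ^ k)"
      by (rule sum.subset_diff[OF P]) simp
    also have "\<dots> \<le> (\<Sum>r\<in>?V - ?P. real (card ?K) ^ k / 2 ^ k) + (\<Sum>r\<in>?P. real (card ?K) ^ k)"
      using in_P not_in_P by (intro add_mono sum_mono) (auto simp del: set_simps)
    \<comment> \<open>One factor \<open>card ?K\<close> combines with \<open>card ?P\<close> to
      \<open>2 ^ m\<close>. The exponent thereby drops to \<open>k'\<close>, which is why the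
      hypothesis on \<open>k\<close> grows with \<open>j\<close>.\<close>
    also have "(\<Sum>r\<in>?P. real (card ?K) ^ k) = real (card ?K * card ?P) * real (card ?K) ^ k'"
      by (simp add: k')
    also have "\<dots> = 2 ^ m * real (card ?K) ^ k'"
      by (subst card_annihilator_mult[OF rsV]) simp
    also have "(\<Sum>r\<in>?V - ?P. real (card ?K) ^ k / 2 ^ k) \<le> (\<Sum>r\<in>?V. real (card ?K) ^ k / 2 ^ k)"
      by (rule sum_mono2) auto
    also have "\<dots> = real (card ?K) ^ k * (2 ^ m / 2 ^ k)"
      by (simp add: card_bit_vec)
    \<comment> \<open>Since \<open>m \<le> k\<close>, all \<open>2 ^ m\<close> rows, each damped by
      \<open>2 ^ k\<close>, weigh at most as much as one undamped row.\<close>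
    also have "\<dots> \<le> real (card ?K) ^ k"
      using Suc.prems by (intro mult_right_le_one_le) (auto simp: power_increasing)
    finally show ?thesis by simp
  qed
  have "(\<Sum>rs | set rs \<subseteq> ?V \<and> length rs = Suc j. real (card (annihilator m (set rs))) ^ k)
      \<le> (\<Sum>rs\<in>?L. 2 ^ m * real (card (annihilator m (set rs))) ^ k'
        + real (card (annihilator m (set rs))) ^ k)"
    unfolding sum_lists_Suc by (rule sum_mono) (rule step)
  also have "\<dots> = 2 ^ m * (\<Sum>rs\<in>?L. real (card (annihilator m (set rs))) ^ k')
      + (\<Sum>rs\<in>?L. real (card (annihilator m (set rs))) ^ k)"
    by (simp add: sum.distrib sum_distrib_left)
  \<comment> \<open>The induction hypothesis is used with both exponents \<open>k'\<close> and
    \<open>k\<close>; the two terms are equal, so each row costs a factor 2.\<close>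
  also have "\<dots> \<le> 2 ^ m * (2 ^ j * 2 ^ (m * k')) + 2 ^ j * 2 ^ (m * k)"
    using Suc.prems k' by (intro add_mono mult_left_mono Suc.IH) auto
  also have "\<dots> = 2 ^ Suc j * 2 ^ (m * k)"
    by (simp add: k' power_add)
  finally show ?case .
qed

subsection \<open>Correlation with weighted queries\<close>

text \<open>Both sides say that \<open>v\<close> lies in the kernel of \<open>M\<close>; the left
  one is the condition that \<open>sum_sgn_scalar_prod\<close> produces when \<open>W\<close> is the
  whole space.\<close>

lemma mult_mat_vec_annihilator_iff:
  assumes "M \<in> carrier_mat m m" "v \<in> carrier_vec m"
  shows "M *\<^sub>v v \<in> annihilator m (carrier_vec m) \<longleftrightarrow> v \<in> annihilator m (set (rows M))"
proof -
  have "M *\<^sub>v v = 0\<^sub>v m \<longleftrightarrow> (\<forall>i<m. scalar_prod (row M i) v = 0)"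
    using assms by (auto simp: vec_eq_iff)
  also have "\<dots> \<longleftrightarrow> (\<forall>r\<in>set (rows M). scalar_prod r v = 0)"
    using assms by (auto simp: rows_def)
  finally show ?thesis
    using assms unfolding annihilator_carrier by (simp add: annihilator_def)
qed

lemma finite_uMv [simp]: "finite (uMv_inputs m)" "finite (uMv_queries m)"
  by (simp_all add: uMv_inputs_def uMv_queries_def)

lemma card_uMv: "card (uMv_inputs m) = 2 ^ (m * m)" "card (uMv_queries m) = 2 ^ (2 * m)"
  by (simp_all add: uMv_inputs_def uMv_queries_def card_bit_mat card_cartesian_product card_bit_vec
      power_add[symmetric])

text \<open>For fixed \<open>v\<close> the sum over \<open>u\<close> vanishes unless
  \<open>M\<close> maps \<open>v\<close> to 0.\<close>

lemma sum_sgn_uMv: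
  assumes M: "M \<in> uMv_inputs m"
  shows "(\<Sum>x\<in>uMv_queries m. sgn_bit (uMv M x)) = 2 ^ m * real (card (annihilator m (set (rows M))))"
proof -
  let ?V = "carrier_vec m :: bit Matrix.vec set"
  have M': "M \<in> carrier_mat m m" using M by (simp add: uMv_inputs_def)
  have "(\<Sum>x\<in>uMv_queries m. sgn_bit (uMv M x)) = (\<Sum>u\<in>?V. \<Sum>v\<in>?V. sgn_bit (scalar_prod u (M *\<^sub>v v)))"
    by (simp add: uMv_queries_def uMv_def sum.cartesian_product case_prod_unfold)
  also have "\<dots> = (\<Sum>v\<in>?V. \<Sum>u\<in>?V. sgn_bit (scalar_prod u (M *\<^sub>v v)))"
    by (rule sum.swap)
  also have "\<dots> = (\<Sum>v\<in>?V. \<Sum>u\<in>?V. sgn_bit (scalar_prod (M *\<^sub>v v) u))"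
    by (intro sum.cong refl arg_cong[of _ _ sgn_bit] comm_scalar_prod[of _ m])
      (use M' in auto)
  also have "\<dots> = (\<Sum>v\<in>?V. if v \<in> annihilator m (set (rows M)) then 2 ^ m else 0)"
  proof (rule sum.cong[OF refl])
    fix v assume v: "v \<in> ?V"
    have "M *\<^sub>v v \<in> ?V" using M' v by simp
    then show "(\<Sum>u\<in>?V. sgn_bit (scalar_prod (M *\<^sub>v v) u))
        = (if v \<in> annihilator m (set (rows M)) then 2 ^ m else 0)"
      using mult_mat_vec_annihilator_iff[OF M' v]
      by (subst sum_sgn_scalar_prod[of _ m]) (auto simp: card_bit_vec)
  qed
  also have "\<dots> = 2 ^ m * real (card (annihilator m (set (rows M))))"
    using annihilator_subset[of m "set (rows M)"]
    by (subst sum.inter_restrict[symmetric]) (auto simp: Int_absorb1)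
  finally show ?thesis .
qed

text \<open>\<open>2 * m\<close> is the least exponent that
  \<open>sum_card_annihilator_power_le\<close> admits for \<open>m\<close> rows in dimension
  \<open>m\<close>. Being even, it also keeps later moments nonnegative.\<close>

lemma sum_uMv_moment_le:
  "(\<Sum>M\<in>uMv_inputs m. (\<Sum>x\<in>uMv_queries m. sgn_bit (uMv M x)) ^ (2 * m)) \<le> 2 ^ (4 * m * m + m)"
proof -
  have "(\<Sum>M\<in>uMv_inputs m. (\<Sum>x\<in>uMv_queries m. sgn_bit (uMv M x)) ^ (2 * m))
      = (\<Sum>M\<in>uMv_inputs m. 2 ^ (m * (2 * m)) * real (card (annihilator m (set (rows M)))) ^ (2 * m))"
    by (intro sum.cong refl) (simp only: sum_sgn_uMv power_mult_distrib power_mult)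
  also have "\<dots> = 2 ^ (m * (2 * m)) *
      (\<Sum>M\<in>carrier_mat m m. real (card (annihilator m (set (rows M)))) ^ (2 * m))"
    by (simp add: uMv_inputs_def sum_distrib_left)
  also have "(\<Sum>M\<in>carrier_mat m m. real (card (annihilator m (set (rows M)))) ^ (2 * m))
      = (\<Sum>rs | set rs \<subseteq> carrier_vec m \<and> length rs = m. real (card (annihilator m (set rs))) ^ (2 * m))"
    by (rule sum.reindex_bij_betw[OF bij_betw_rows])
  also have "2 ^ (m * (2 * m)) * \<dots> \<le> 2 ^ (m * (2 * m)) * (2 ^ m * 2 ^ (m * (2 * m)))"
    by (intro mult_left_mono sum_card_annihilator_power_le) auto
  also have "\<dots> = 2 ^ (4 * m * m + m)"
    by (simp add: power_add[symmetric])
  finally show ?thesis .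
qed

lemma sum_power_eq_sum_lists:
  fixes f :: "'a \<Rightarrow> 'b :: comm_semiring_1"
  shows "(\<Sum>x\<in>A. f x) ^ k = (\<Sum>xs | set xs \<subseteq> A \<and> length xs = k. prod_list (map f xs))"
proof (induction k)
  case 0
  have "{xs. set xs \<subseteq> A \<and> length xs = 0} = {[]}" by auto
  then show ?case by simp
next
  case (Suc k)
  then show ?case
    unfolding sum_lists_Suc by (simp add: sum_product sum.swap[of _ A] sum_distrib_left sum_distrib_right)
qed

lemma uMv_add:
  assumes "M \<in> uMv_inputs m" "N \<in> uMv_inputs m" "x \<in> uMv_queries m"
  shows "uMv (M + N) x = uMv M x + uMv N x"
proof -
  obtain u v where x: "x = (u, v)" "u \<in> carrier_vec m" "v \<in> carrier_vec m"
    using assms(3) by (auto simp: uMv_queries_def)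
  then show ?thesis
    using assms(1,2) unfolding uMv_inputs_def uMv_def
    by (simp add: add_mult_distrib_mat_vec[of _ m m] scalar_prod_add_distrib[of _ m] del: add_bit_eq_xor)
qed

text \<open>As \<open>uMv\<close> is additive in the matrix, the product of signs is a character of
  the additive group of matrices; its sum is the group order or 0.\<close>

lemma sum_prod_sgn_uMv_nonneg:
  assumes xs: "set xs \<subseteq> uMv_queries m"
  shows "(\<Sum>M\<in>uMv_inputs m. prod_list (map (\<lambda>x. sgn_bit (uMv M x)) xs)) \<ge> 0"
proof -
  define \<psi> where "\<psi> M = prod_list (map (\<lambda>x. sgn_bit (uMv M x)) xs)" for M
  have \<psi>_add: "\<psi> (M + N) = \<psi> M * \<psi> N" if "M \<in> uMv_inputs m" "N \<in> uMv_inputs m" for M N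
    using xs unfolding \<psi>_def
    by (induction xs) (simp_all add: uMv_add[OF that] sgn_bit_add del: add_bit_eq_xor)
  show ?thesis
  proof (cases "\<forall>M\<in>uMv_inputs m. \<psi> M = 1")
    case True
    then show ?thesis by (simp add: \<psi>_def)
  next
    case False
    then obtain H where H: "H \<in> uMv_inputs m" "\<psi> H \<noteq> 1" by auto
    have "bij_betw ((+) H) (uMv_inputs m) (uMv_inputs m)"
      by (rule bij_betw_involution)
        (use H bit_mat_add_cancel[of H m m] in \<open>auto simp: uMv_inputs_def\<close>)
    then have "sum \<psi> (uMv_inputs m) = 0"
      by (rule sum_character_eq_0[where c = "\<psi> H"]) (use H \<psi>_add in auto)
    then show ?thesis by (simp add: \<psi>_def)
  qed
qed

lemma abs_prod_list_le_1:
  fixes f :: "'a \<Rightarrow> real"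
  assumes "\<And>x. \<bar>f x\<bar> \<le> 1"
  shows "\<bar>prod_list (map f xs)\<bar> \<le> 1"
  by (induction xs) (auto simp: abs_mult intro!: mult_le_one assms)

text \<open>Expanding the power over tuples of queries, each nonnegative mixed moment is multiplied
  by a product of weights, which is at most 1.\<close>

lemma weighted_uMv_moment_le:
  fixes \<sigma> :: "bit Matrix.vec \<times> bit Matrix.vec \<Rightarrow> real"
  assumes \<sigma>: "\<And>x. \<bar>\<sigma> x\<bar> \<le> 1"
  shows "(\<Sum>M\<in>uMv_inputs m. (\<Sum>x\<in>uMv_queries m. \<sigma> x * sgn_bit (uMv M x)) ^ k)
           \<le> (\<Sum>M\<in>uMv_inputs m. (\<Sum>x\<in>uMv_queries m. sgn_bit (uMv M x)) ^ k)"
proof -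
  let ?L = "{xs. set xs \<subseteq> uMv_queries m \<and> length xs = k}"
  have "(\<Sum>M\<in>uMv_inputs m. (\<Sum>x\<in>uMv_queries m. \<sigma> x * sgn_bit (uMv M x)) ^ k)
      = (\<Sum>xs\<in>?L. \<Sum>M\<in>uMv_inputs m. prod_list (map (\<lambda>x. \<sigma> x * sgn_bit (uMv M x)) xs))"
    unfolding sum_power_eq_sum_lists by (rule sum.swap)
  also have "\<dots> = (\<Sum>xs\<in>?L. prod_list (map \<sigma> xs) *
      (\<Sum>M\<in>uMv_inputs m. prod_list (map (\<lambda>x. sgn_bit (uMv M x)) xs)))"
  proof -
    have "prod_list (map (\<lambda>x. \<sigma> x * g x) xs) = prod_list (map \<sigma> xs) * prod_list (map g xs)"
      for g :: "_ \<Rightarrow> real" and xs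
      by (induction xs) simp_all
    then show ?thesis by (simp add: sum_distrib_left)
  qed
  also have "\<dots> \<le> (\<Sum>xs\<in>?L. 1 *
      (\<Sum>M\<in>uMv_inputs m. prod_list (map (\<lambda>x. sgn_bit (uMv M x)) xs)))"
    using abs_prod_list_le_1[of \<sigma>, OF \<sigma>] sum_prod_sgn_uMv_nonneg
    by (intro sum_mono mult_right_mono) (auto simp: abs_le_iff)
  also have "\<dots> = (\<Sum>M\<in>uMv_inputs m. (\<Sum>x\<in>uMv_queries m. sgn_bit (uMv M x)) ^ k)"
    unfolding sum_power_eq_sum_lists mult_1 by (rule sum.swap)
  finally show ?thesis .
qed

subsection \<open>Cell sampling\<close>

lemma run_probes_cong:
  assumes "\<And>i. i \<in> set (probes mem a) \<Longrightarrow> mem' i = mem i"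
  shows "run mem' a = run mem a" "probes mem' a = probes mem a"
  using assms by (induction a) auto

text \<open>The value 0 marks a discarded query. Testing the padded probe set lets every query
  survive equally often, however few cells it probes.\<close>

definition sampled ::
    "(nat set \<Rightarrow> nat set) \<Rightarrow> nat set \<Rightarrow> (nat \<Rightarrow> bool list) \<Rightarrow> bit probe_alg \<Rightarrow> real" where
  "sampled pad C mem a = (if pad (set (probes mem a)) \<subseteq> C then sgn_bit (run mem a) else 0)"

lemma abs_sampled_le_1: "\<bar>sampled pad C mem a\<bar> \<le> 1"
  by (simp add: sampled_def)

text \<open>If one of the two runs stays inside \<open>C\<close>, the runs coincide; otherwise both
  are discarded, because padding only enlarges the probe sets.\<close>

lemma sampled_cong:
  assumes pad: "\<And>P. P \<subseteq> pad P" and eq: "\<And>i. i \<in> C \<Longrightarrow> mem' i = mem i"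
  shows "sampled pad C mem' a = sampled pad C mem a"
proof -
  consider "set (probes mem a) \<subseteq> C" | "set (probes mem' a) \<subseteq> C"
    | "\<not> set (probes mem a) \<subseteq> C" "\<not> set (probes mem' a) \<subseteq> C" by blast
  then show ?thesis
  proof cases
    case 1
    then have "run mem' a = run mem a" "probes mem' a = probes mem a"
      using eq by (auto intro!: run_probes_cong)
    then show ?thesis by (simp add: sampled_def)
  next
    case 2
    then have "run mem a = run mem' a" "probes mem a = probes mem' a"
      using eq by (auto intro!: run_probes_cong)
    then show ?thesis by (simp add: sampled_def)
  next
    case 3
    then have "\<not> pad (set (probes mem a)) \<subseteq> C" "\<not> pad (set (probes mem' a)) \<subseteq> C"
      using pad by (meson order_trans)+
    then show ?thesis by (simp add: sampled_def)
  qed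
qed

text \<open>For a fixed set of cells, the sampled answers depend on the input only through the contents
  of these cells. Summing over all possible contents leaves weights that do not depend on the input.\<close>

lemma sampled_moment_le:
  assumes pad: "\<And>P. P \<subseteq> pad P"
    and len: "\<And>M i. M \<in> uMv_inputs m \<Longrightarrow> i \<in> C \<Longrightarrow> length (mem M i) = w"
    and C: "finite C"
  shows "(\<Sum>M\<in>uMv_inputs m.
            (\<Sum>x\<in>uMv_queries m. sampled pad C (mem M) (alg x) * sgn_bit (uMv M x)) ^ (2 * m))
           \<le> 2 ^ (card C * w) * 2 ^ (4 * m * m + m)"
proof -
  let ?D = "uMv_inputs m"
  define \<K> where "\<K> = PiE C (\<lambda>_. {xs :: bool list. set xs \<subseteq> UNIV \<and> length xs = w})"
  define f where "f \<kappa> M = (\<Sum>x\<in>uMv_queries m. sampled pad C \<kappa> (alg x) * sgn_bit (uMv M x)) ^ (2 * m)"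
    for \<kappa> M
  have fin: "finite \<K>"
    unfolding \<K>_def using C by (intro finite_PiE finite_lists_length_eq) auto
  have card: "card \<K> = 2 ^ (card C * w)"
    unfolding \<K>_def using C
    by (simp add: card_PiE card_lists_length_eq[where A = UNIV, simplified] power_mult[symmetric] mult.commute)
  have nonneg: "f \<kappa> M \<ge> 0" for \<kappa> M
    by (simp add: f_def power_mult)
  \<comment> \<open>The true content of \<open>C\<close> is one element of \<open>\<K>\<close>; the
    terms of all others are even powers, so adding them only increases the sum.\<close>
  have "(\<Sum>M\<in>?D. f (mem M) M) \<le> (\<Sum>M\<in>?D. \<Sum>\<kappa>\<in>\<K>. f \<kappa> M)"
  proof (rule sum_mono)
    fix M assume M: "M \<in> ?D"
    have "restrict (mem M) C \<in> \<K>"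
      using len[OF M] by (auto simp: \<K>_def)
    moreover have "f (mem M) M = f (restrict (mem M) C) M"
      unfolding f_def by (subst sampled_cong[OF pad, of C "restrict (mem M) C" "mem M"]) auto
    ultimately show "f (mem M) M \<le> (\<Sum>\<kappa>\<in>\<K>. f \<kappa> M)"
      using member_le_sum[of "restrict (mem M) C" \<K> "\<lambda>\<kappa>. f \<kappa> M"] nonneg fin by simp
  qed
  also have "\<dots> = (\<Sum>\<kappa>\<in>\<K>. \<Sum>M\<in>?D. f \<kappa> M)"
    by (rule sum.swap)
  also have "\<dots> \<le> (\<Sum>\<kappa>\<in>\<K>. 2 ^ (4 * m * m + m))"
    unfolding f_def
    by (intro sum_mono order_trans[OF weighted_uMv_moment_le sum_uMv_moment_le] abs_sampled_le_1)
  also have "\<dots> = 2 ^ (card C * w) * 2 ^ (4 * m * m + m)"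
    by (simp add: card)
  finally show ?thesis unfolding f_def .
qed

text \<open>Jensen's inequality for an even power.\<close>

lemma sum_power_le_card_power_sum:
  fixes f :: "'a \<Rightarrow> real"
  assumes "finite A" "even k" "k > 0"
  shows "(\<Sum>x\<in>A. f x) ^ k \<le> real (card A) ^ (k - 1) * (\<Sum>x\<in>A. f x ^ k)"
proof (cases "A = {}")
  case False
  then have c: "real (card A) > 0" using assms(1) by (simp add: card_gt_0_iff)
  have "(\<Sum>x\<in>A. (1 / real (card A)) *\<^sub>R f x) ^ k \<le> (\<Sum>x\<in>A. (1 / real (card A)) * f x ^ k)"
    by (rule convex_on_sum[OF assms(1) False convex_power_even[OF assms(2)]]) (use c in auto)
  then have "((\<Sum>x\<in>A. f x) / real (card A)) ^ k \<le> (\<Sum>x\<in>A. f x ^ k) / real (card A)"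
    by (simp add: sum_divide_distrib)
  then have "(\<Sum>x\<in>A. f x) ^ k \<le> (\<Sum>x\<in>A. f x ^ k) / real (card A) * real (card A) ^ k"
    using c by (simp add: power_divide pos_divide_le_eq)
  also have "\<dots> = real (card A) ^ (k - 1) * (\<Sum>x\<in>A. f x ^ k)"
    using c assms(3) by (cases k) simp_all
  finally show ?thesis .
qed (use assms in \<open>simp add: power_0_left\<close>)

text \<open>Jensen and a \<open>2 * m\<close>-th root. Against the trivial exponent
  \<open>m ^ 2 + 2 * m\<close>, the gain is
  \<open>m / 2 - 1 / 2 - card C * w / (2 * m)\<close>.\<close>

lemma sampled_sum_le:
  assumes pad: "\<And>P. P \<subseteq> pad P"
    and len: "\<And>M i. M \<in> uMv_inputs m \<Longrightarrow> i \<in> C \<Longrightarrow> length (mem M i) = w"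
    and C: "finite C" and m: "m > 0"
  shows "(\<Sum>M\<in>uMv_inputs m. \<Sum>x\<in>uMv_queries m. sampled pad C (mem M) (alg x) * sgn_bit (uMv M x))
           \<le> 2 powr (real m ^ 2 + 3 / 2 * real m + real (card C) * real w / (2 * real m) + 1 / 2)"
    (is "?S \<le> 2 powr ?e")
proof -
  have "?S ^ (2 * m) \<le> real (card (uMv_inputs m)) ^ (2 * m - 1) *
      (2 ^ (card C * w) * 2 ^ (4 * m * m + m))"
    using m by (intro order_trans[OF sum_power_le_card_power_sum] mult_left_mono
        sampled_moment_le pad len C) auto
  also have "\<dots> = 2 ^ (m * m * (2 * m - 1) + (card C * w + (4 * m * m + m)))"
    by (simp add: card_uMv power_add power_mult)
  also have "\<dots> = 2 powr real (m * m * (2 * m - 1) + (card C * w + (4 * m * m + m)))"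
    by (rule powr_realpow[symmetric]) simp
  also have "real (m * m * (2 * m - 1) + (card C * w + (4 * m * m + m))) = ?e * real (2 * m)"
    using m by (simp add: of_nat_diff field_simps power2_eq_square)
  also have "2 powr (?e * real (2 * m)) = (2 powr ?e) ^ (2 * m)"
    by (simp add: powr_power mult.commute)
  \<comment> \<open>The root needs only the right-hand base to be nonnegative, so \<open>?S\<close>
    may be negative; the rule writes the exponent as \<open>Suc (2 * m - 1)\<close>.\<close>
  finally show ?thesis
    using m power_le_imp_le_base[of ?S "2 * m - 1" "2 powr ?e"] by simp
qed

section \<open>Averaging over the sampled sets of cells\<close>

lemma card_supersets:
  assumes A: "finite A" "P \<subseteq> A" and q: "card P \<le> q"
  shows "card {C. C \<subseteq> A \<and> card C = q \<and> P \<subseteq> C} = (card A - card P) choose (q - card P)"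
proof -
  have P: "finite P" using A by (rule rev_finite_subset)
  have "bij_betw (\<lambda>C. C - P) {C. C \<subseteq> A \<and> card C = q \<and> P \<subseteq> C} {B. B \<subseteq> A - P \<and> card B = q - card P}"
  proof (rule bij_betw_byWitness[where f' = "\<lambda>B. B \<union> P"])
    show "(\<lambda>C. C - P) ` {C. C \<subseteq> A \<and> card C = q \<and> P \<subseteq> C} \<subseteq> {B. B \<subseteq> A - P \<and> card B = q - card P}"
      using P by (auto simp: card_Diff_subset)
    show "(\<lambda>B. B \<union> P) ` {B. B \<subseteq> A - P \<and> card B = q - card P} \<subseteq> {C. C \<subseteq> A \<and> card C = q \<and> P \<subseteq> C}"
    proof (rule image_subsetI)
      fix B assume B: "B \<in> {B. B \<subseteq> A - P \<and> card B = q - card P}"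
      then have "finite B" "B \<inter> P = {}" using A by (auto intro: finite_subset)
      then have "card (B \<union> P) = q" using B P q by (simp add: card_Un_disjoint)
      then show "B \<union> P \<in> {C. C \<subseteq> A \<and> card C = q \<and> P \<subseteq> C}" using B A by auto
    qed
  qed auto
  then have "card {C. C \<subseteq> A \<and> card C = q \<and> P \<subseteq> C} = card {B. B \<subseteq> A - P \<and> card B = q - card P}"
    by (rule bij_betw_same_card)
  also have "\<dots> = (card A - card P) choose (q - card P)"
    using A P by (simp add: n_subsets card_Diff_subset)
  finally show ?thesis .
qed

text \<open>Correctly answered pairs of input and query minus wrongly answered ones.\<close>

definition advantage_sum :: "nat \<Rightarrow> (bit Matrix.mat, bit Matrix.vec \<times> bit Matrix.vec, bit) data_structure \<Rightarrow> real" where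
  "advantage_sum m S =
     (\<Sum>M\<in>uMv_inputs m. \<Sum>x\<in>uMv_queries m. sgn_bit (answer S M x) * sgn_bit (uMv M x))"

text \<open>Each pair survives for exactly \<open>(s - \<tau>) choose (q - \<tau>)\<close> of the
  sets \<open>C\<close>, so summing the bound for a single \<open>C\<close> suffices. The case
  \<open>\<tau> = s\<close> allows any \<open>t\<close>, since a run meets at most \<open>s\<close>
  distinct cells.\<close>

lemma cell_sampling:
  assumes ds: "cell_probe_ds (uMv_inputs m) (uMv_queries m) s w t S"
    and m: "m > 0" and \<tau>: "\<tau> \<le> q" "q \<le> s" "t \<le> \<tau> \<or> \<tau> = s"
  shows "real (q choose \<tau>) * advantage_sum m S
    \<le> real (s choose \<tau>) * 2 powr (real m ^ 2 + 3 / 2 * real m + real q * real w / (2 * real m) + 1 / 2)"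
    (is "_ \<le> _ * ?B")
proof -
  let ?D = "uMv_inputs m" and ?Q = "uMv_queries m"
  define Cs where "Cs = {C. C \<subseteq> {..<s} \<and> card C = q}"
  define good where "good P P' \<longleftrightarrow> P \<subseteq> P' \<and> P' \<subseteq> {..<s} \<and> card P' = \<tau>" for P P'
  \<comment> \<open>The identity is the default because \<open>sampled_sum_le\<close> needs
    \<open>P \<subseteq> pad P\<close> for every \<open>P\<close>: it also runs queries on contents
    stored for no input, where the probe bounds may fail.\<close>
  define pad where "pad P = (if P \<subseteq> {..<s} \<and> card P \<le> \<tau> then SOME P'. good P P' else P)" for P
  have good_pad: "good P (pad P)" if "P \<subseteq> {..<s}" "card P \<le> \<tau>" for P
  proof -
    have "\<exists>P'. good P P'"
      unfolding good_def using exists_subset_between[of P \<tau> "{..<s}"] that \<tau> by auto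
    then show ?thesis
      using that someI_ex[of "good P"] by (simp add: pad_def)
  qed
  have pad: "P \<subseteq> pad P" for P
    using good_pad[of P] by (cases "P \<subseteq> {..<s} \<and> card P \<le> \<tau>") (auto simp: good_def pad_def)
  define samp where "samp C M x = sampled pad C (store S M) (query S x)" for C M x
  have fin: "finite Cs" unfolding Cs_def by simp
  have avg: "(\<Sum>C\<in>Cs. samp C M x) = real ((s - \<tau>) choose (q - \<tau>)) * sgn_bit (answer S M x)"
    if "M \<in> ?D" "x \<in> ?Q" for M x
  proof -
    let ?P = "set (probes (store S M) (query S x))"
    have P: "?P \<subseteq> {..<s}" "length (probes (store S M) (query S x)) \<le> t"
      using ds that by (auto simp: cell_probe_ds_def)
    then have "card ?P \<le> t" "card ?P \<le> s"
      using card_length[of "probes (store S M) (query S x)"] card_mono[OF _ P(1)] by auto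
    then have good: "good ?P (pad ?P)"
      using P \<tau>(3) by (intro good_pad) auto
    have "(\<Sum>C\<in>Cs. samp C M x) = (\<Sum>C\<in>{C \<in> Cs. pad ?P \<subseteq> C}. sgn_bit (answer S M x))"
      unfolding samp_def sampled_def answer_def by (rule sum.inter_filter[OF fin, symmetric])
    also have "{C \<in> Cs. pad ?P \<subseteq> C} = {C. C \<subseteq> {..<s} \<and> card C = q \<and> pad ?P \<subseteq> C}"
      by (auto simp: Cs_def)
    finally show ?thesis
      using good \<tau> by (simp add: good_def card_supersets)
  qed
  have "real ((s - \<tau>) choose (q - \<tau>)) * advantage_sum m S
      = (\<Sum>M\<in>?D. \<Sum>x\<in>?Q. (\<Sum>C\<in>Cs. samp C M x) * sgn_bit (uMv M x))"
    unfolding advantage_sum_def sum_distrib_left by (intro sum.cong refl) (simp add: avg)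
  also have "\<dots> = (\<Sum>M\<in>?D. \<Sum>C\<in>Cs. \<Sum>x\<in>?Q. samp C M x * sgn_bit (uMv M x))"
    unfolding sum_distrib_right by (intro sum.cong refl sum.swap)
  also have "\<dots> = (\<Sum>C\<in>Cs. \<Sum>M\<in>?D. \<Sum>x\<in>?Q. samp C M x * sgn_bit (uMv M x))"
    by (rule sum.swap)
  also have "\<dots> \<le> (\<Sum>C\<in>Cs. ?B)"
  proof (rule sum_mono)
    fix C assume C: "C \<in> Cs"
    have "finite C" using C unfolding Cs_def by (auto intro: finite_subset)
    moreover have "length (store S M i) = w" if "M \<in> ?D" "i \<in> C" for M i
      using ds C that by (auto simp: cell_probe_ds_def Cs_def)
    ultimately show "(\<Sum>M\<in>?D. \<Sum>x\<in>?Q. samp C M x * sgn_bit (uMv M x)) \<le> ?B"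
      using sampled_sum_le[of pad m C "store S" w "query S"] pad m C
      unfolding samp_def Cs_def by simp
  qed
  also have "\<dots> = real (s choose q) * ?B"
    by (simp add: Cs_def n_subsets)
  finally have "real (s choose \<tau>) * (real ((s - \<tau>) choose (q - \<tau>)) * advantage_sum m S)
      \<le> real (s choose \<tau>) * (real (s choose q) * ?B)"
    by (rule mult_left_mono) simp
  \<comment> \<open>Pairs of a \<open>q\<close>-set and a \<open>\<tau>\<close>-subset of it,
    counted in both orders; then \<open>s choose q\<close> cancels.\<close>
  moreover have "real (s choose q) * real (q choose \<tau>) = real (s choose \<tau>) * real ((s - \<tau>) choose (q - \<tau>))"
    using choose_mult[OF \<tau>(1,2)] by (metis of_nat_mult)
  ultimately have "real (s choose q) * (real (q choose \<tau>) * advantage_sum m S)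
      \<le> real (s choose q) * (real (s choose \<tau>) * ?B)"
    by (simp only: mult.assoc[symmetric]) (simp only: mult_ac)
  then show ?thesis
    using \<tau> by (simp add: mult_le_cancel_left_pos)
qed

section \<open>Randomized data structures\<close>

lemma advantage_le:
  assumes sol: "solves_with_prob (uMv_inputs m) (uMv_queries m) uMv p R"
    and le: "\<And>S. S \<in> set_pmf R \<Longrightarrow> advantage_sum m S \<le> b"
  shows "(2 * p - 1) * 2 ^ (m * m + 2 * m) \<le> b"
proof -
  let ?D = "uMv_inputs m" and ?Q = "uMv_queries m"
  let ?g = "\<lambda>M x S. sgn_bit (answer S M x) * sgn_bit (uMv M x)"
  have int: "integrable (measure_pmf R) (?g M x)" for M x
    by (rule measure_pmf.integrable_const_bound[where B = 1]) (auto simp: abs_mult)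
  have ge: "2 * p - 1 \<le> measure_pmf.expectation R (?g M x)" if "M \<in> ?D" "x \<in> ?Q" for M x
  proof -
    have "?g M x = (\<lambda>S. 2 * indicator {S. answer S M x = uMv M x} S - 1)"
      by (rule ext, auto simp: indicator_def sgn_bit_def split: if_splits)
    moreover have "integrable (measure_pmf R) (indicat_real {S. answer S M x = uMv M x})"
      by (rule measure_pmf.integrable_const_bound[where B = 1]) auto
    ultimately have "measure_pmf.expectation R (?g M x) = 2 * measure_pmf.prob R {S. answer S M x = uMv M x} - 1"
      by (simp add: Bochner_Integration.integral_diff measure_pmf.prob_space)
    then show ?thesis
      using sol that by (auto simp: solves_with_prob_def)
  qed
  have "(2 * p - 1) * 2 ^ (m * m + 2 * m) = (\<Sum>M\<in>?D. \<Sum>x\<in>?Q. 2 * p - 1)"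
    by (simp add: card_uMv power_add)
  also have "\<dots> \<le> (\<Sum>M\<in>?D. \<Sum>x\<in>?Q. measure_pmf.expectation R (?g M x))"
    by (intro sum_mono ge)
  also have "\<dots> = measure_pmf.expectation R (advantage_sum m)"
    unfolding advantage_sum_def
    by (subst Bochner_Integration.integral_sum, intro Bochner_Integration.integrable_sum int,
        intro sum.cong refl Bochner_Integration.integral_sum[symmetric] int)
  also have "\<dots> \<le> b"
  proof (rule measure_pmf.integral_le_const)
    show "integrable (measure_pmf R) (advantage_sum m)"
      unfolding advantage_sum_def by (intro Bochner_Integration.integrable_sum int)
    show "AE S in measure_pmf R. advantage_sum m S \<le> b"
      using le by (simp add: AE_measure_pmf_iff)
  qed
  finally show ?thesis .
qed

text \<open>As \<open>2 * k \<le> q\<close>, no factor \<open>q - i\<close> falls below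
  \<open>q / 2\<close>; so the survival ratio is at least \<open>(q / (2 * s)) ^ k\<close>, stated
  here without division.\<close>

lemma binomial_ratio:
  assumes "2 * k \<le> q" "q \<le> s"
  shows "real q ^ k * real (s choose k) \<le> real (q choose k) * (2 * real s) ^ k"
proof -
  have le: "k \<le> q" "k \<le> s" using assms by auto
  have "real q ^ k * real (s choose k) = (\<Prod>i = 0..<k. real q * (real (s - i) / real (k - i)))"
    by (simp only: binomial_altdef_of_nat[OF le(1)] binomial_altdef_of_nat[OF le(2)]
        prod.distrib prod_constant card_atLeastLessThan diff_zero power_mult_distrib)
  also have "\<dots> \<le> (\<Prod>i = 0..<k. real (q - i) / real (k - i) * (2 * real s))"
  proof (intro prod_mono conjI)
    fix i assume i: "i \<in> {0..<k}"
    have "real q * real (s - i) \<le> (2 * real (q - i)) * real s"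
      using i assms by (intro mult_mono) (auto simp: of_nat_diff)
    then show "real q * (real (s - i) / real (k - i)) \<le> real (q - i) / real (k - i) * (2 * real s)"
      by (simp add: divide_simps mult_ac)
  qed simp
  also have "\<dots> = real (q choose k) * (2 * real s) ^ k"
    by (simp only: binomial_altdef_of_nat[OF le(1)] binomial_altdef_of_nat[OF le(2)]
        prod.distrib prod_constant card_atLeastLessThan diff_zero power_mult_distrib)
  finally show ?thesis .
qed

text \<open>The promised advantage is \<open>2 powr (1 - m / 64)\<close> per pair; with the gain
  \<open>m / 2 - 1 / 2\<close> from the moments this leaves
  \<open>31 / 64 * m + 1 / 2\<close>.\<close>

lemma randomized_cell_sampling:
  assumes ds: "randomized_cell_probe_ds (uMv_inputs m) (uMv_queries m) s w t R"
    and sol: "solves_with_prob (uMv_inputs m) (uMv_queries m) uMv (1 / 2 + 1 / 2 powr (real m / 64)) R"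
    and m: "m > 0" and \<tau>: "\<tau> \<le> q" "q \<le> s" "t \<le> \<tau> \<or> \<tau> = s"
  shows "real (q choose \<tau>) * 2 powr (31 / 64 * real m + 1 / 2 - real q * real w / (2 * real m))
           \<le> real (s choose \<tau>)"
proof -
  let ?e = "real m ^ 2 + 3 / 2 * real m + real q * real w / (2 * real m) + 1 / 2"
  have pos: "real (q choose \<tau>) > 0" using \<tau> by simp
  have "advantage_sum m S \<le> real (s choose \<tau>) * 2 powr ?e / real (q choose \<tau>)" if "S \<in> set_pmf R" for S
    using cell_sampling[OF _ m \<tau>, of w S] ds that pos
    by (simp add: randomized_cell_probe_ds_def pos_le_divide_eq mult.commute)
  then have "(2 * (1 / 2 + 1 / 2 powr (real m / 64)) - 1) * 2 ^ (m * m + 2 * m)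
      \<le> real (s choose \<tau>) * 2 powr ?e / real (q choose \<tau>)"
    by (rule advantage_le[OF sol])
  moreover have "(2 * (1 / 2 + 1 / 2 powr (real m / 64)) - 1) * 2 ^ (m * m + 2 * m)
      = 2 powr (1 - real m / 64 + real m ^ 2 + 2 * real m)"
  proof -
    have "(2::real) ^ (m * m + 2 * m) = 2 powr (real m ^ 2 + 2 * real m)"
      using powr_realpow[of 2 "m * m + 2 * m"] by (simp add: power2_eq_square)
    moreover have "2 * (1 / 2 + 1 / 2 powr (real m / 64)) - 1 = 2 powr (1 - real m / 64)"
      by (simp add: powr_diff)
    ultimately show ?thesis by (simp add: powr_add[symmetric])
  qed
  ultimately have "real (q choose \<tau>) * 2 powr (1 - real m / 64 + real m ^ 2 + 2 * real m)
      \<le> real (s choose \<tau>) * 2 powr ?e"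
    using pos by (simp add: pos_le_divide_eq mult.commute)
  also have "1 - real m / 64 + real m ^ 2 + 2 * real m
      = (31 / 64 * real m + 1 / 2 - real q * real w / (2 * real m)) + ?e"
    by simp
  finally have "(real (q choose \<tau>) * 2 powr (31 / 64 * real m + 1 / 2 - real q * real w / (2 * real m)))
      * 2 powr ?e \<le> real (s choose \<tau>) * 2 powr ?e"
    by (simp only: powr_add mult.assoc)
  then show ?thesis by (rule mult_right_le_imp_le) simp
qed

subsection \<open>The trade-off\<close>

text \<open>Sampling the whole memory, \<open>\<tau> = q = s\<close>, makes both binomials 1. Below
  the bound the memory costs at most \<open>7 / 16 * m\<close>, less than
  \<open>31 / 64 * m\<close>.\<close>

lemma small_memory_impossible:
  assumes "randomized_cell_probe_ds (uMv_inputs m) (uMv_queries m) s w t R"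
    and "solves_with_prob (uMv_inputs m) (uMv_queries m) uMv (1 / 2 + 1 / 2 powr (real m / 64)) R"
    and m: "m > 0"
  shows "7 / 8 * real m ^ 2 \<le> real s * real w"
proof (rule ccontr)
  assume "\<not> ?thesis"
  then have "real s * real w / (2 * real m) \<le> 7 / 16 * real m"
    using m by (simp add: divide_simps power2_eq_square)
  moreover have "2 powr (31 / 64 * real m + 1 / 2 - real s * real w / (2 * real m)) \<le> 2 powr 0"
    using randomized_cell_sampling[OF assms, of s s] by simp
  then have "31 / 64 * real m + 1 / 2 - real s * real w / (2 * real m) \<le> 0"
    by (rule powr_le_cancel_iff[THEN iffD1, rotated]) simp
  ultimately show False
    using m by linarith
qed

lemma log2_ge_minus_fifth:
  assumes "(7::real) / 8 \<le> r"
  shows "- 1 / 5 \<le> log 2 r"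
proof -
  have "(1::real) / 2 \<le> (7 / 8) ^ 5" by (simp add: power_divide)
  also have "\<dots> \<le> r ^ 5" using assms by (intro power_mono) auto
  finally have "log 2 (1 / 2) \<le> log 2 (r ^ 5)" using assms by simp
  then show ?thesis using assms by (simp add: log_nat_power log_divide)
qed

lemma log2_ge_quarter:
  assumes "(7::real) / 5 \<le> b"
  shows "1 / 4 \<le> log 2 b"
proof -
  have "(2::real) \<le> (7 / 5) ^ 4" by (simp add: power_divide)
  also have "\<dots> \<le> b ^ 4" using assms by (intro power_mono) auto
  finally have "log 2 2 \<le> log 2 (b ^ 4)" using assms by simp
  then show ?thesis using assms by (simp add: log_nat_power)
qed

lemma query_time_lower_bound:
  fixes m s w t :: nat
  assumes ds: "randomized_cell_probe_ds (uMv_inputs m) (uMv_queries m) s w t R"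
    and sol: "solves_with_prob (uMv_inputs m) (uMv_queries m) uMv (1 / 2 + 1 / 2 powr (real m / 64)) R"
    and m: "m > 0"
    and \<alpha>: "real w \<le> \<alpha>" and \<beta>: "7 / 5 \<le> real s * \<alpha> / real m ^ 2"
  shows "real t \<ge> min (1 / 100 * real m / log 2 (real s * \<alpha> / real m ^ 2)) (1 / 100 * real m ^ 2 / \<alpha>)"
proof (rule ccontr)
  define b where "b = real s * \<alpha> / real m ^ 2"
  define N where "N = real m ^ 2"
  have N: "N > 0" using m by (simp add: N_def)
  have \<alpha>0: "\<alpha> > 0" using \<beta> \<alpha> by (cases "\<alpha> = 0") (auto intro: order.not_eq_order_implies_strict[of 0])
  have lg: "1 / 4 \<le> log 2 b" using log2_ge_quarter[OF \<beta>] by (simp add: b_def)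
  assume "\<not> ?thesis"
  then have "real t < 1 / 100 * real m / log 2 b" and "real t < 1 / 100 * N / \<alpha>"
    by (auto simp: b_def N_def)
  then have t1: "real t * log 2 b < real m / 100" and t2: "real t * 100 < N / \<alpha>"
    using lg \<alpha>0 by (auto simp: field_simps)
  \<comment> \<open>The most cells with \<open>q * \<alpha> \<le> N / 2\<close>; as
    \<open>w \<le> \<alpha>\<close>, they hold at most \<open>N / 2\<close> bits.\<close>
  define q where "q = nat \<lfloor>N / (2 * \<alpha>)\<rfloor>"
  have q_le: "real q \<le> N / (2 * \<alpha>)" and q_gt: "N / (2 * \<alpha>) - 1 < real q"
    using N \<alpha>0 unfolding q_def by (auto simp: of_nat_nat)
  have "N \<le> real s * \<alpha>"
    using \<beta> N by (simp add: N_def[symmetric] pos_le_divide_eq)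
  then have "N / (2 * \<alpha>) \<le> real s"
    using \<alpha>0 N by (simp add: pos_divide_le_eq)
  then have qs: "q \<le> s" using q_le by linarith
  define y where "y = N / \<alpha>"
  have y: "N / (4 * \<alpha>) = y / 4" "N / (2 * \<alpha>) = y / 2" "real t * 100 < y"
    using t2 by (simp_all add: y_def)
  \<comment> \<open>For \<open>t \<ge> 1\<close> the bound \<open>y > 100\<close> absorbs the
    rounding. For \<open>t = 0\<close>, \<open>q\<close> may be 0, but then all \<open>t\<close>-th
    powers are 1.\<close>
  have q_big: "t = 0 \<or> y / 4 \<le> real q"
    using q_gt y by linarith
  then have qt: "2 * t \<le> q"
    using y by linarith
  \<comment> \<open>The sampled bits cost \<open>m / 4\<close>, which is \<open>16 / 64\<close> of
    the available \<open>31 / 64\<close>.\<close>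
  have E: "15 / 64 * real m \<le> 31 / 64 * real m + 1 / 2 - real q * real w / (2 * real m)" (is "_ \<le> ?E")
  proof -
    have "real q * real w \<le> N / (2 * \<alpha>) * \<alpha>"
      using q_le \<alpha> by (intro mult_mono) auto
    also have "\<dots> = real m * real m / 2" using \<alpha>0 by (simp add: N_def power2_eq_square)
    finally have "real q * real w / (2 * real m) \<le> real m / 4"
      using m by (simp add: divide_simps)
    then show ?thesis by simp
  qed
  have c: "real (s choose t) > 0" using qt qs by simp
  have "real q ^ t * 2 powr ?E * real (s choose t) \<le> real (q choose t) * (2 * real s) ^ t * 2 powr ?E"
    using mult_right_mono[OF binomial_ratio[OF qt qs], of "2 powr ?E"] by (simp add: mult_ac)
  also have "\<dots> = (real (q choose t) * 2 powr ?E) * (2 * real s) ^ t"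
    by (simp add: mult_ac)
  also have "\<dots> \<le> real (s choose t) * (2 * real s) ^ t"
    using randomized_cell_sampling[OF ds sol m, of t q] qt qs by (intro mult_right_mono) auto
  finally have *: "real q ^ t * 2 powr ?E \<le> (2 * real s) ^ t"
    using c by (simp add: mult.commute)
  have "(N / (4 * \<alpha>)) ^ t \<le> real q ^ t"
    using q_big y(1) N \<alpha>0 by (cases "t = 0") (auto intro: power_mono)
  then have "(N / (4 * \<alpha>)) ^ t * 2 powr ?E \<le> (2 * real s) ^ t"
    by (rule order_trans[OF mult_right_mono *]) simp
  then have "2 powr ?E \<le> (2 * real s) ^ t / (N / (4 * \<alpha>)) ^ t"
    using N \<alpha>0 by (simp add: pos_le_divide_eq mult.commute)
  \<comment> \<open>The 8 is the 2 of \<open>binomial_ratio\<close> times the 4 of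
    \<open>q \<ge> N / (4 * \<alpha>)\<close>.\<close>
  also have "\<dots> = (8 * b) ^ t"
  proof -
    have "2 * real s / (N / (4 * \<alpha>)) = 8 * b"
      using N \<alpha>0 by (simp add: b_def N_def[symmetric])
    then show ?thesis by (simp only: power_divide[symmetric])
  qed
  also have "8 * b = 2 powr (3 + log 2 b)"
    using \<beta> by (simp add: powr_add b_def[symmetric])
  also have "(2 powr (3 + log 2 b)) ^ t = 2 powr (real t * (3 + log 2 b))"
    by (simp add: powr_power)
  finally have "?E \<le> real t * (3 + log 2 b)" by simp
  \<comment> \<open>\<open>log 2 b \<ge> 1 / 4\<close> absorbs the 3 into
    \<open>12 * log 2 b\<close>. The contradiction is then
    \<open>13 / 100 < 15 / 64\<close>.\<close>
  also have "\<dots> \<le> real t * (13 * log 2 b)"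
    using lg by (intro mult_left_mono) auto
  also have "\<dots> < 13 / 100 * real m" using t1 by simp
  finally show False using E m by simp
qed

theorem theorem1p3:
  "\<exists>c::real. 0 < c \<and> c \<le> 1 / 36 \<and>
     (\<forall>(n::nat) (m::nat) (s::nat) (w::nat) (t::nat)
        (R :: (bit Matrix.mat, bit Matrix.vec \<times> bit Matrix.vec, bit) data_structure pmf).
        n = m ^ 2 \<longrightarrow>
        randomized_cell_probe_ds (uMv_inputs m) (uMv_queries m) s w t R \<longrightarrow>
        solves_with_prob (uMv_inputs m) (uMv_queries m) uMv
          (1 / 2 + 1 / 2 powr (sqrt (real n) / 64)) R \<longrightarrow>
        (let \<alpha> = 2 * (real w + log 2 (real s * real w / real n))
         in real t \<ge> min (c * sqrt (real n) / log 2 (real s * \<alpha> / real n))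
                         (c * real n / \<alpha>)))"
proof (intro exI[of _ "1 / 100"] conjI allI impI)
  fix n m s w t :: nat
    and R :: "(bit Matrix.mat, bit Matrix.vec \<times> bit Matrix.vec, bit) data_structure pmf"
  assume n: "n = m ^ 2"
    and ds: "randomized_cell_probe_ds (uMv_inputs m) (uMv_queries m) s w t R"
    and "solves_with_prob (uMv_inputs m) (uMv_queries m) uMv (1 / 2 + 1 / 2 powr (sqrt (real n) / 64)) R"
  then have sol: "solves_with_prob (uMv_inputs m) (uMv_queries m) uMv (1 / 2 + 1 / 2 powr (real m / 64)) R"
    by simp
  \<comment> \<open>For \<open>m = 0\<close> the required success probability would be
    \<open>3 / 2\<close>.\<close>
  have m: "m > 0"
  proof (rule ccontr)
    assume "\<not> ?thesis"
    then have "(1 / 2 + 1 :: real) \<le> measure_pmf.prob R {S. answer S (0\<^sub>m m m) (0\<^sub>v m, 0\<^sub>v m) = uMv (0\<^sub>m m m) (0\<^sub>v m, 0\<^sub>v m)}"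
      using sol by (auto simp: solves_with_prob_def uMv_inputs_def uMv_queries_def)
    also have "\<dots> \<le> 1" by (rule measure_pmf.prob_le_1)
    finally show False by simp
  qed
  define \<alpha> where "\<alpha> = 2 * (real w + log 2 (real s * real w / real n))"
  define r where "r = real s * real w / real n"
  have sw: "7 / 8 * real n \<le> real s * real w"
    using small_memory_impossible[OF ds sol m] by (simp add: n)
  have n0: "real n > 0" using m by (simp add: n)
  have r: "7 / 8 \<le> r" using sw n0 by (simp add: r_def pos_le_divide_eq)
  have "w > 0" using r by (cases w) (auto simp: r_def)
  then have w1: "1 \<le> real w" by simp
  \<comment> \<open>The logarithm costs at most \<open>2 / 5\<close> in \<open>\<alpha>\<close>, and
    \<open>2 * w - 2 / 5 \<ge> 8 / 5 * w\<close> because \<open>w \<ge> 1\<close>.\<close>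
  have \<alpha>_ge: "8 / 5 * real w \<le> \<alpha>"
    using log2_ge_minus_fifth[OF r] w1 by (simp add: \<alpha>_def r_def)
  then have \<alpha>: "real w \<le> \<alpha>" using w1 by linarith
  have "7 / 5 \<le> 8 / 5 * r" using r by simp
  also have "\<dots> = real s * (8 / 5 * real w) / real n" by (simp add: r_def)
  also have "\<dots> \<le> real s * \<alpha> / real n"
    using \<alpha>_ge by (intro divide_right_mono mult_left_mono) auto
  finally have \<beta>: "7 / 5 \<le> real s * \<alpha> / real m ^ 2" by (simp add: n)
  show "let \<alpha> = 2 * (real w + log 2 (real s * real w / real n))
         in real t \<ge> min (1 / 100 * sqrt (real n) / log 2 (real s * \<alpha> / real n)) (1 / 100 * real n / \<alpha>)"
    using query_time_lower_bound[OF ds sol m \<alpha> \<beta>] unfolding Let_def \<alpha>_def[symmetric] by (simp add: n)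
qed simp_all

end
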